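(* Let $d\geq 6$ be an integer and let $G$ be a finite simple $d$-regular graph whose adjacency eigenvalues are $\lambda_1(G)\geq \lambda_2(G)\geq \dots\geq \lambda_n(G)$. If $\lambda_2(G)<d-\frac{5}{d+1}$, then $G$ contains at least $3$ edge-disjoint spanning trees.
   Context: The adjacency matrix $A$ of a graph $G$ on $n$ vertices has $(u,v)$-entry $1$ if $uv$ is an edge and $0$ otherwise; its eigenvalues are real and ordered $\lambda_1\geq\lambda_2\geq\dots\geq\lambda_n$. *)

theory Defs
  imports
    "Jordan_Normal_Form.Char_Poly"
    "HOL-Library.Multiset"
    "HOL-Library.Disjoint_Sets"
begin

definition finite_simple_graph :: "'a set \<Rightarrow> 'a set set \<Rightarrow> bool" where
  "finite_simple_graph V E \<longleftrightarrow>
     finite V \<and> V \<noteq> {} \<and> (\<forall>e\<in>E. \<exists>u\<in>V. \<exists>v\<in>V. u \<noteq> v \<and> e = {u, v})"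

definition degree_in :: "'a set set \<Rightarrow> 'a \<Rightarrow> nat" where
  "degree_in E v = card {e \<in> E. v \<in> e}"

definition regular_graph :: "'a set \<Rightarrow> 'a set set \<Rightarrow> nat \<Rightarrow> bool" where
  "regular_graph V E d \<longleftrightarrow> (\<forall>v\<in>V. degree_in E v = d)"

definition connected_graph :: "'a set \<Rightarrow> 'a set set \<Rightarrow> bool" where
  "connected_graph V E \<longleftrightarrow>
     V \<noteq> {} \<and> (\<forall>u\<in>V. \<forall>v\<in>V. (u, v) \<in> {(x, y). {x, y} \<in> E}\<^sup>*)"

(* The list gives the vertices of the cycle in order, the first one not repeated at the end. *)
definition is_cycle :: "'a set set \<Rightarrow> 'a list \<Rightarrow> bool" where
  "is_cycle E c \<longleftrightarrow>
     3 \<le> length c \<and> distinct c \<and>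
     (\<forall>i<length c. {c ! i, c ! (Suc i mod length c)} \<in> E)"

definition tree_graph :: "'a set \<Rightarrow> 'a set set \<Rightarrow> bool" where
  "tree_graph V T \<longleftrightarrow>
     finite_simple_graph V T \<and> connected_graph V T \<and> (\<nexists>c. is_cycle T c)"

(* A spanning tree of (V, E) is identified with its set of edges. *)
definition spanning_tree_of :: "'a set \<Rightarrow> 'a set set \<Rightarrow> 'a set set \<Rightarrow> bool" where
  "spanning_tree_of V E T \<longleftrightarrow> T \<subseteq> E \<and> tree_graph V T"

(* Rows and columns are indexed by an enumeration vs of the vertices; a different
   enumeration conjugates the matrix by a permutation matrix. *)
definition adjacency_matrix :: "'a list \<Rightarrow> 'a set set \<Rightarrow> real mat" where
  "adjacency_matrix vs E =
     mat (length vs) (length vs) (\<lambda>(i, j). if {vs ! i, vs ! j} \<in> E then 1 else 0)"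

(* Real eigenvalues in nonincreasing order, repeated by algebraic multiplicity.  For a
   symmetric matrix these are all its eigenvalues. *)
definition eigenvalues_desc :: "real mat \<Rightarrow> real list" where
  "eigenvalues_desc A = rev (sorted_list_of_multiset (proots (char_poly A)))"

(* Indices start at 1: the list is zero-based. *)
definition adj_eigenvalue :: "'a list \<Rightarrow> 'a set set \<Rightarrow> nat \<Rightarrow> real" where
  "adj_eigenvalue vs E i = eigenvalues_desc (adjacency_matrix vs E) ! (i - 1)"

end

theory Submission
  imports Defs "HOL-Analysis.Function_Topology"
begin

text \<open>
  Tree packing (Nash-Williams, Tutte) is derived from Rado's theorem on independent transversals:
  the edges are to be coloured so that each of the three tree colours is a forest, with a
  fourth colour of bounded size for the unused edges.  If this is impossible, some edge
  set \<open>J\<close> has \<open>t\<close> components and fewer than \<open>3 (t - 1)\<close> edges outside it, so the numbers \<open>r C\<close>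
  of edges leaving the components \<open>C\<close> satisfy \<open>\<Sum> (6 - r C) \<ge> 8\<close>.  Counting then yields
  two components \<open>C\<close>, \<open>D\<close> with \<open>r C, r D \<le> 5\<close> and \<open>r C + r D + 2 e(C, D) \<le> 10\<close>.  As \<open>d \<ge> 6\<close>,
  both have at least \<open>d + 1\<close> vertices, and the vector with value \<open>1 / card C\<close> on \<open>C\<close>,
  \<open>- 1 / card D\<close> on \<open>D\<close> and \<open>0\<close> elsewhere is orthogonal to the vector of ones and has
  Rayleigh quotient at least \<open>d - 5 / (d + 1)\<close>.
\<close>

section \<open>Tree packing\<close>

text \<open>
  While some \<open>A i\<close> has two elements, one of any two of them can be deleted from \<open>A i\<close> without
  destroying Hall's condition: otherwise two violated sets contradict submodularity.
\<close>

theorem rado: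
  fixes rk :: "'b set \<Rightarrow> nat" and A :: "'i \<Rightarrow> 'b set"
  assumes fin: "finite I" and finA: "\<And>i. i \<in> I \<Longrightarrow> finite (A i)"
    and mono: "\<And>X Y. X \<subseteq> Y \<Longrightarrow> finite Y \<Longrightarrow> rk X \<le> rk Y"
    and submod: "\<And>X Y. finite X \<Longrightarrow> finite Y \<Longrightarrow> rk (X \<union> Y) + rk (X \<inter> Y) \<le> rk X + rk Y"
    and empty: "rk {} = 0"
    and hall: "\<And>J. J \<subseteq> I \<Longrightarrow> card J \<le> rk (\<Union>(A ` J))"
  shows "\<exists>f. (\<forall>i\<in>I. f i \<in> A i) \<and> (\<forall>J\<subseteq>I. card J \<le> rk (f ` J))"
  using finA hall
proof (induction "\<Sum>i\<in>I. card (A i)" arbitrary: A rule: less_induct)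
  case less
  have ne: "A i \<noteq> {}" if "i \<in> I" for i
    using less.prems(2)[of "{i}"] that empty by auto
  show ?case
  proof (cases "\<forall>i\<in>I. card (A i) = 1")
    case True
    then have "\<forall>i\<in>I. \<exists>a. A i = {a}" by (auto simp: card_1_singleton_iff)
    then obtain f where f: "\<And>i. i \<in> I \<Longrightarrow> A i = {f i}" by metis
    have "card J \<le> rk (f ` J)" if "J \<subseteq> I" for J
    proof -
      have "\<Union>(A ` J) = f ` J" using f that by (force simp: subset_iff)
      then show ?thesis using less.prems(2)[OF that] by simp
    qed
    then show ?thesis using f by auto
  next
    case False
    then obtain i where i: "i \<in> I" "card (A i) \<noteq> 1" by auto
    obtain a where a: "a \<in> A i" using ne[OF i(1)] by auto
    with i(2) obtain b where b: "b \<in> A i" "b \<noteq> a"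
      by (metis is_singletonI' is_singleton_altdef empty_iff)
    define B where "B c = A(i := A i - {c})" for c
    have unfold_B: "\<Union>(B c ` J) = \<Union>(A ` (J - {i})) \<union> (A i - {c})" if "i \<in> J" for J c
      using that by (auto simp: B_def split: if_splits)
    have finB: "finite (B c j)" if "j \<in> I" for c j
      using less.prems(1)[OF that] by (auto simp: B_def)
    \<comment> \<open>Only \<open>A i\<close> shrinks, so a set violating Hall's condition for
      \<open>B c\<close> contains \<open>i\<close>. Taking \<open>i\<close> out lowers the
      cardinality by one, which turns the strict violation into a weak inequality for
      \<open>K\<close>.\<close>
    have violated: "\<exists>K. K \<subseteq> I - {i} \<and> rk (\<Union>(A ` K) \<union> (A i - {c})) \<le> card K"
      if bad: "\<not> (\<forall>J\<subseteq>I. card J \<le> rk (\<Union>(B c ` J)))" for c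
    proof -
      obtain J where J: "J \<subseteq> I" "\<not> card J \<le> rk (\<Union>(B c ` J))" using bad by auto
      have "i \<in> J"
      proof (rule ccontr)
        assume "i \<notin> J"
        then have "\<Union>(B c ` J) = \<Union>(A ` J)" by (auto simp: B_def)
        then show False using J less.prems(2) by auto
      qed
      have "finite J" using J(1) fin finite_subset by blast
      then have "card J = Suc (card (J - {i}))" using \<open>i \<in> J\<close> by (rule card.remove)
      then show ?thesis using J unfold_B[OF \<open>i \<in> J\<close>, of c]
        by (intro exI[of _ "J - {i}"]) auto
    qed
    have "\<exists>c\<in>{a, b}. \<forall>J\<subseteq>I. card J \<le> rk (\<Union>(B c ` J))"
    proof (rule ccontr)
      assume no: "\<not> ?thesis"
      obtain K where K: "K \<subseteq> I - {i}" "rk (\<Union>(A ` K) \<union> (A i - {a})) \<le> card K"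
        using violated[of a] no by auto
      obtain L where L: "L \<subseteq> I - {i}" "rk (\<Union>(A ` L) \<union> (A i - {b})) \<le> card L"
        using violated[of b] no by auto
      \<comment> \<open>As \<open>a\<close> and \<open>b\<close> differ,
        \<open>?X \<union> ?Y\<close> regains all of \<open>A i\<close>, so Hall's condition for
        \<open>insert i (K \<union> L)\<close> gains one there, while \<open>?X \<inter> ?Y\<close>
        still contains all \<open>A j\<close> with \<open>j\<close> in \<open>K \<inter> L\<close>.
        Submodularity then gives \<open>card K + card L + 1 \<le> card K + card L\<close>.\<close>
      let ?X = "\<Union>(A ` K) \<union> (A i - {a})" and ?Y = "\<Union>(A ` L) \<union> (A i - {b})"
      have finKL: "finite K" "finite L" using K L fin by (meson finite_Diff finite_subset)+
      have finXY: "finite ?X" "finite ?Y"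
        using finKL K(1) L(1) i(1) less.prems(1) by auto
      have un: "?X \<union> ?Y = \<Union>(A ` insert i (K \<union> L))" using a b by auto
      have "card (K \<union> L) + 1 \<le> rk (?X \<union> ?Y)"
      proof -
        have "card (insert i (K \<union> L)) = card (K \<union> L) + 1"
          using finKL K(1) L(1) by (subst card_insert_disjoint) auto
        moreover have "card (insert i (K \<union> L)) \<le> rk (\<Union>(A ` insert i (K \<union> L)))"
          using K(1) L(1) i(1) by (intro less.prems(2)) auto
        ultimately show ?thesis unfolding un by linarith
      qed
      moreover have "card (K \<inter> L) \<le> rk (?X \<inter> ?Y)"
      proof -
        have "card (K \<inter> L) \<le> rk (\<Union>(A ` (K \<inter> L)))"
          using K(1) by (intro less.prems(2)) auto
        also have "\<dots> \<le> rk (?X \<inter> ?Y)" using finXY by (intro mono) auto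
        finally show ?thesis .
      qed
      moreover have "rk (?X \<union> ?Y) + rk (?X \<inter> ?Y) \<le> rk ?X + rk ?Y"
        using finXY by (rule submod)
      moreover have "card (K \<union> L) + card (K \<inter> L) = card K + card L"
        using card_Un_Int[OF finKL] by simp
      ultimately show False using K(2) L(2) by linarith
    qed
    then obtain c where c: "c \<in> A i" "\<forall>J\<subseteq>I. card J \<le> rk (\<Union>(B c ` J))" using a b by auto
    have "card (B c i) < card (A i)"
      using card_Diff1_less[OF less.prems(1)[OF i(1)] c(1)] by (simp only: B_def fun_upd_same)
    then have "(\<Sum>j\<in>I. card (B c j)) < (\<Sum>j\<in>I. card (A j))"
      using fin i(1) by (intro sum_strict_mono_ex1) (auto simp: B_def)
    from less.hyps[OF this finB] c(2)
    obtain f where "\<forall>j\<in>I. f j \<in> B c j" "\<forall>J\<subseteq>I. card J \<le> rk (f ` J)" by blast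
    then show ?thesis by (intro exI[of _ f]) (auto simp: B_def split: if_splits)
  qed
qed

section \<open>Reachability and the number of components\<close>

definition linked :: "'a set set \<Rightarrow> 'a \<Rightarrow> 'a \<Rightarrow> bool" where
  "linked E u v \<longleftrightarrow> (u, v) \<in> {(x, y). {x, y} \<in> E}\<^sup>*"

lemma linked_refl [simp]: "linked E u u"
  by (simp add: linked_def)

lemma linked_trans: "linked E u v \<Longrightarrow> linked E v w \<Longrightarrow> linked E u w"
  unfolding linked_def by (rule rtrancl_trans)

lemma linked_edge: "{u, v} \<in> E \<Longrightarrow> linked E u v"
  unfolding linked_def by (intro r_into_rtrancl) simp

lemma linked_sym: "linked E u v \<longleftrightarrow> linked E v u"
proof -
  have "sym {(x, y). {x, y} \<in> E}" by (auto simp: sym_def insert_commute)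
  then show ?thesis unfolding linked_def by (meson sym_rtrancl symD)
qed

lemma linked_mono: "E \<subseteq> F \<Longrightarrow> linked E u v \<Longrightarrow> linked F u v"
  unfolding linked_def by (rule subsetD[OF rtrancl_mono]) auto

lemma linked_empty: "linked {} u v \<longleftrightarrow> u = v"
  by (simp add: linked_def)

lemma connected_graph_iff_linked:
  "connected_graph V E \<longleftrightarrow> V \<noteq> {} \<and> (\<forall>u\<in>V. \<forall>v\<in>V. linked E u v)"
  by (simp add: connected_graph_def linked_def)

text \<open>A walk can be shortened until it uses the new edge at most once, in one of two
  directions. Inserting the two ordered pairs one after the other also produces mixed cases, which
  collapse by transitivity.\<close>

lemma linked_insert:
  "linked (insert {u, v} E) x y \<longleftrightarrow>
     linked E x y \<or> linked E x u \<and> linked E v y \<or> linked E x v \<and> linked E u y"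
proof -
  have "{(x, y). {x, y} \<in> insert {u, v} E} = insert (u, v) (insert (v, u) {(x, y). {x, y} \<in> E})"
    by (auto simp: doubleton_eq_iff)
  then have "linked (insert {u, v} E) x y \<longleftrightarrow>
      linked E x y \<or> linked E x v \<and> linked E u y \<or>
      (linked E x u \<or> linked E x v) \<and> (linked E v y \<or> linked E u y)"
    by (simp add: linked_def rtrancl_insert)
  then show ?thesis by (meson linked_trans)
qed

definition graph_component :: "'a set \<Rightarrow> 'a set set \<Rightarrow> 'a \<Rightarrow> 'a set" where
  "graph_component V E u = {v \<in> V. linked E u v}"

definition graph_components :: "'a set \<Rightarrow> 'a set set \<Rightarrow> 'a set set" where
  "graph_components V E = graph_component V E ` V"

lemma graph_component_eq_iff:
  assumes "u \<in> V" "v \<in> V"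
  shows "graph_component V E u = graph_component V E v \<longleftrightarrow> linked E u v"
proof
  assume "graph_component V E u = graph_component V E v"
  moreover have "v \<in> graph_component V E v" using assms by (simp add: graph_component_def)
  ultimately have "v \<in> graph_component V E u" by simp
  then show "linked E u v" by (simp add: graph_component_def)
next
  assume "linked E u v"
  then have "linked E u w \<longleftrightarrow> linked E v w" for w by (metis linked_sym linked_trans)
  then show "graph_component V E u = graph_component V E v" by (simp add: graph_component_def)
qed

lemma graph_components_disjoint:
  assumes "C \<in> graph_components V E" "D \<in> graph_components V E" "C \<noteq> D"
  shows "C \<inter> D = {}"
proof (rule ccontr)
  assume "C \<inter> D \<noteq> {}"
  moreover obtain x y where xy: "x \<in> V" "y \<in> V" "C = graph_component V E x" "D = graph_component V E y"
    using assms(1,2) by (auto simp: graph_components_def)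
  ultimately obtain z where "linked E x z" "linked E y z" by (auto simp: graph_component_def)
  then have "linked E x y" by (metis linked_sym linked_trans)
  then show False using graph_component_eq_iff[OF xy(1,2)] xy(3,4) assms(3) by blast
qed

lemma finite_components: "finite V \<Longrightarrow> finite (graph_components V E)"
  by (simp add: graph_components_def)

text \<open>A new edge merges the components of its ends and changes nothing if these already
  coincide. The additive form avoids truncated subtraction.\<close>

lemma card_components_insert:
  assumes "finite V" "u \<in> V" "v \<in> V"
  shows "card (graph_components V E) =
    card (graph_components V (insert {u, v} E)) + (if linked E u v then 0 else 1)"
proof (cases "linked E u v")
  case True
  then have "linked (insert {u, v} E) x y \<longleftrightarrow> linked E x y" for x y
    unfolding linked_insert by (metis linked_sym linked_trans)
  then show ?thesis using True by (simp add: graph_components_def graph_component_def cong: image_cong)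
next
  case False
  let ?C = "graph_component V E" and ?F = "insert {u, v} E"
  have new: "graph_component V ?F x =
      (if linked E x u \<or> linked E x v then ?C u \<union> ?C v else ?C x)" for x
  proof (rule Set.set_eqI)
    fix y
    have "linked ?F x y \<longleftrightarrow> (if linked E x u \<or> linked E x v
        then linked E u y \<or> linked E v y else linked E x y)"
      unfolding linked_insert by (metis (full_types) linked_sym linked_trans)
    then show "y \<in> graph_component V ?F x \<longleftrightarrow> y \<in> (if linked E x u \<or> linked E x v
        then ?C u \<union> ?C v else ?C x)"
      by (auto simp: graph_component_def split: if_splits)
  qed
  have "graph_components V ?F = insert (?C u \<union> ?C v) (graph_components V E - {?C u, ?C v})"
  proof (rule Set.set_eqI)
    fix X
    have "X \<in> graph_components V ?F \<longleftrightarrow> (\<exists>x\<in>V. X = graph_component V ?F x)"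
      by (auto simp: graph_components_def)
    also have "\<dots> \<longleftrightarrow> X = ?C u \<union> ?C v \<or> (\<exists>x\<in>V. X = ?C x \<and> \<not> linked E x u \<and> \<not> linked E x v)"
      using assms(2) unfolding new by (auto split: if_splits)
    also have "\<dots> \<longleftrightarrow> X \<in> insert (?C u \<union> ?C v) (graph_components V E - {?C u, ?C v})"
      using graph_component_eq_iff[OF _ assms(2), of _ E] graph_component_eq_iff[OF _ assms(3), of _ E]
      by (auto simp: graph_components_def)
    finally show "X \<in> graph_components V ?F \<longleftrightarrow> \<dots>" .
  qed
  \<comment> \<open>Together with \<open>?C u \<noteq> ?C v\<close> this makes the count drop by
    exactly one: two components disappear and a genuinely new one appears.\<close>
  moreover have "?C u \<union> ?C v \<notin> graph_components V E"
  proof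
    assume "?C u \<union> ?C v \<in> graph_components V E"
    then obtain x where "?C u \<union> ?C v = ?C x" by (auto simp: graph_components_def)
    moreover have "u \<in> ?C u" "v \<in> ?C v" using assms by (auto simp: graph_component_def)
    ultimately have "u \<in> ?C x" "v \<in> ?C x" by blast+
    then have "linked E x u" "linked E x v" by (simp_all add: graph_component_def)
    then show False using False by (metis linked_sym linked_trans)
  qed
  moreover have "?C u \<noteq> ?C v" using graph_component_eq_iff[OF assms(2,3)] False by auto
  moreover have "{?C u, ?C v} \<subseteq> graph_components V E" using assms by (auto simp: graph_components_def)
  moreover have "card {?C u, ?C v} \<le> card (graph_components V E)"
    using calculation(4) finite_components[OF assms(1)] by (rule card_mono[rotated])
  ultimately show ?thesis using False finite_components[OF assms(1), of E]
    by (simp add: card_Diff_subset)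
qed

text \<open>This is submodularity of the graphic rank in terms of component counts. The edges of
  \<open>S\<close> are inserted one at a time; an edge that merges nothing over
  \<open>A \<union> S\<close> merges nothing over the larger \<open>B \<union> S\<close>, so the
  count for \<open>B\<close> never drops by more than the one for \<open>A\<close>.\<close>

lemma card_components_diminishing_returns:
  assumes "finite V" "A \<subseteq> B" "finite S" "\<forall>e\<in>S. \<exists>u\<in>V. \<exists>v\<in>V. e = {u, v}"
  shows "card (graph_components V B) + card (graph_components V (A \<union> S))
       \<le> card (graph_components V A) + card (graph_components V (B \<union> S))"
  using assms(3,4)
proof (induction S rule: finite_induct)
  case empty
  then show ?case by simp
next
  case (insert e S)
  then obtain u v where e: "u \<in> V" "v \<in> V" "e = {u, v}" by auto
  have "linked (A \<union> S) u v \<Longrightarrow> linked (B \<union> S) u v"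
    using assms(2) by (intro linked_mono[of "A \<union> S" "B \<union> S"]) auto
  then show ?case
    using insert card_components_insert[OF assms(1) e(1,2), of "A \<union> S"]
      card_components_insert[OF assms(1) e(1,2), of "B \<union> S"]
    by (auto simp: e(3) split: if_splits)
qed

lemma card_components_antimono:
  assumes "finite V" "A \<subseteq> B" "finite B" "\<forall>e\<in>B. \<exists>u\<in>V. \<exists>v\<in>V. e = {u, v}"
  shows "card (graph_components V B) \<le> card (graph_components V A)"
proof -
  have "card (graph_components V (A \<union> S)) \<le> card (graph_components V A)"
    if "finite S" "\<forall>e\<in>S. \<exists>u\<in>V. \<exists>v\<in>V. e = {u, v}" for S
    using that
  proof (induction S rule: finite_induct)
    case (insert e S)
    then obtain u v where e: "u \<in> V" "v \<in> V" "e = {u, v}" by auto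
    then show ?case
      using insert card_components_insert[OF assms(1) e(1,2), of "A \<union> S"] by auto
  qed simp
  from this[of B] show ?thesis using assms by (simp add: Un_absorb1)
qed


section \<open>Spanning trees of connected graphs\<close>

text \<open>The ends of an edge on a cycle stay linked through the rest of the cycle.\<close>

lemma connected_graph_remove_cycle_edge:
  assumes conn: "connected_graph V T" and cyc: "is_cycle T c"
  shows "\<exists>e\<in>T. connected_graph V (T - {e})"
proof -
  let ?l = "length c"
  \<comment> \<open>The closing edge is the one removed, so the remaining path follows the list
    without wrapping around.\<close>
  define e where "e = {c ! (?l - 1), c ! 0}"
  have l: "3 \<le> ?l" and dist: "distinct c"
    and edge: "\<And>i. i < ?l \<Longrightarrow> {c ! i, c ! (Suc i mod ?l)} \<in> T"
    using cyc by (auto simp: is_cycle_def)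
  have index_eq: "c ! i = c ! j \<longleftrightarrow> i = j" if "i < ?l" "j < ?l" for i j
    using dist that by (simp add: nth_eq_iff_index_eq)
  have "Suc (?l - 1) = ?l" using l by simp
  then have eT: "e \<in> T" using edge[of "?l - 1"] l by (simp add: e_def)
  have path: "linked (T - {e}) (c ! 0) (c ! j)" if "j < ?l" for j
    using that
  proof (induction j)
    case (Suc j)
    have "{c ! j, c ! Suc j} \<in> T" using edge[of j] Suc.prems by simp
    \<comment> \<open>Consecutive entries of the list could form \<open>e\<close> only in a list of
      length 2, which the lower bound 3 on the length of a cycle excludes.\<close>
    moreover have "{c ! j, c ! Suc j} \<noteq> e"
    proof
      assume "{c ! j, c ! Suc j} = e"
      then consider "c ! j = c ! (?l - 1)" | "c ! j = c ! 0" "c ! Suc j = c ! (?l - 1)"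
        unfolding e_def doubleton_eq_iff by blast
      then show False
      proof cases
        case 1
        then have "j = ?l - 1" using index_eq[of j "?l - 1"] Suc.prems l by linarith
        then show False using Suc.prems by linarith
      next
        case 2
        then have "j = 0" using index_eq[of j 0] Suc.prems l by linarith
        moreover have "Suc j = ?l - 1" using 2 index_eq[of "Suc j" "?l - 1"] Suc.prems l by linarith
        ultimately show False using l by linarith
      qed
    qed
    ultimately have "linked (T - {e}) (c ! j) (c ! Suc j)" by (intro linked_edge) simp
    then show ?case using Suc by (meson Suc_lessD linked_trans)
  qed simp
  have "linked (T - {e}) (c ! 0) (c ! (?l - 1))" using path l by simp
  moreover have "T = insert {c ! (?l - 1), c ! 0} (T - {e})" using eT by (auto simp: e_def)
  ultimately have "linked (T - {e}) x y" if "linked T x y" for x y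
    using that linked_insert[of "c ! (?l - 1)" "c ! 0" "T - {e}" x y]
    by (metis linked_sym linked_trans)
  then show ?thesis using conn eT unfolding connected_graph_iff_linked by blast
qed

lemma finite_simple_graph_finite_edges:
  assumes "finite_simple_graph V E"
  shows "finite E"
proof -
  have "E \<subseteq> Pow V" using assms by (auto simp: finite_simple_graph_def)
  then show ?thesis using assms finite_subset by (auto simp: finite_simple_graph_def)
qed

lemma connected_graph_spanning_tree:
  assumes "finite_simple_graph V F" "connected_graph V F"
  shows "\<exists>T\<subseteq>F. tree_graph V T"
  using assms
proof (induction "card F" arbitrary: F rule: less_induct)
  case less
  show ?case
  proof (cases "\<exists>c. is_cycle F c")
    case True
    then obtain e where e: "e \<in> F" "connected_graph V (F - {e})"
      using connected_graph_remove_cycle_edge[OF less.prems(2)] by blast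
    have "card (F - {e}) < card F"
      using e(1) finite_simple_graph_finite_edges[OF less.prems(1)] by (rule card_Diff1_less[rotated])
    moreover have "finite_simple_graph V (F - {e})"
      using less.prems(1) by (auto simp: finite_simple_graph_def)
    ultimately obtain T where "T \<subseteq> F - {e}" "tree_graph V T" using less.hyps e(2) by blast
    then show ?thesis by blast
  next
    case False
    then show ?thesis using less.prems by (auto simp: tree_graph_def)
  qed
qed

text \<open>The hypothesis \<open>dense\<close> is the partition condition of Nash-Williams and
  Tutte, tested on the partitions into components of edge sets \<open>J\<close>. These are exactly
  the instances into which Rado's condition for the colouring translates.\<close>

theorem tree_packing:
  assumes graph: "finite_simple_graph V E"
    and dense: "\<And>J. J \<subseteq> E \<Longrightarrow> k * (card (graph_components V J) - 1) \<le> card (E - J)"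
  shows "\<exists>T :: nat \<Rightarrow> 'a set set.
           (\<forall>i<k. spanning_tree_of V E (T i)) \<and> disjoint_family_on T {..<k}"
proof -
  have finV: "finite V" and neV: "V \<noteq> {}"
    and ends: "\<forall>e\<in>E. \<exists>u\<in>V. \<exists>v\<in>V. e = {u, v}"
    using graph by (auto simp: finite_simple_graph_def)
  have finE: "finite E" using finite_simple_graph_finite_edges[OF graph] .
  define n where "n = card V"
  \<comment> \<open>The number of edges left over by \<open>k\<close> edge-disjoint spanning trees;
    \<open>dense\<close> for the empty set shows that this subtraction is not truncated. The
    function \<open>gr\<close> below is the rank of the graphic matroid, the largest size of a
    forest inside \<open>F\<close>.\<close>
  define s where "s = card E - k * (n - 1)"
  define gr where "gr F = n - card (graph_components V F)" for F
  have comps_le: "card (graph_components V F) \<le> n" for F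
    unfolding graph_components_def n_def by (rule card_image_le[OF finV])
  have comps_ge: "1 \<le> card (graph_components V F)" for F
    using finite_components[OF finV, of F] neV by (simp add: graph_components_def Suc_le_eq card_gt_0_iff)
  have "graph_component V {} u = {u}" if "u \<in> V" for u
    using that by (auto simp: graph_component_def linked_empty)
  then have comps_empty: "card (graph_components V {}) = n"
    by (simp add: graph_components_def n_def card_image inj_on_def)
  have gr_empty: "gr {} = 0" by (simp add: gr_def comps_empty)
  have gr_mono: "gr F \<le> gr G" if "F \<subseteq> G" "G \<subseteq> E" for F G
  proof -
    have "card (graph_components V G) \<le> card (graph_components V F)"
      using that finE ends finite_subset
      by (intro card_components_antimono[OF finV]) auto
    then show ?thesis by (simp add: gr_def)
  qed
  have gr_submod: "gr (F \<union> G) + gr (F \<inter> G) \<le> gr F + gr G" if "F \<subseteq> E" "G \<subseteq> E" for F G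
  proof -
    have "(F \<inter> G) \<union> G = G" by auto
    then have "card (graph_components V F) + card (graph_components V G)
        \<le> card (graph_components V (F \<inter> G)) + card (graph_components V (F \<union> G))"
      using card_components_diminishing_returns[OF finV, of "F \<inter> G" F G]
        finite_subset[OF that(2) finE] ends that(2) by auto
    then show ?thesis
      using comps_le[of F] comps_le[of G] comps_le[of "F \<inter> G"] comps_le[of "F \<union> G"]
      by (simp add: gr_def)
  qed
  \<comment> \<open>Colours below \<open>k\<close> carry the graphic matroid; colour \<open>k\<close> carries the uniform matroid of
    rank \<open>s\<close> and absorbs the edges that no tree uses.\<close>
  define S where "S c X = {e \<in> E. (e, c) \<in> X}" for c :: nat and X
  have S_E: "S c X \<subseteq> E" and S_fin: "finite (S c X)" for c X
    using finE by (auto simp: S_def)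
  have S_Un: "S c (X \<union> Y) = S c X \<union> S c Y" and S_Int: "S c (X \<inter> Y) = S c X \<inter> S c Y" for c X Y
    by (auto simp: S_def)
  define rk where "rk X = (\<Sum>c<k. gr (S c X)) + min (card (S k X)) s" for X
  \<comment> \<open>The pair \<open>(e, c)\<close> stands for edge \<open>e\<close> in colour
    \<open>c\<close>, so a transversal of the sets \<open>{e} \<times> {..k}\<close> is a colouring,
    and its independence says that every colour class is independent in its own matroid.\<close>
  have "\<exists>f. (\<forall>e\<in>E. f e \<in> {e} \<times> {..k}) \<and> (\<forall>J\<subseteq>E. card J \<le> rk (f ` J))"
  proof (rule rado)
    show "finite E" by (rule finE)
    show "rk {} = 0" by (simp add: rk_def S_def gr_empty)
    show "rk X \<le> rk Y" if "X \<subseteq> Y" for X Y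
    proof -
      have sub: "S c X \<subseteq> S c Y" for c using that by (auto simp: S_def)
      have "card (S k X) \<le> card (S k Y)" by (rule card_mono[OF S_fin sub])
      then show ?thesis unfolding rk_def
        by (intro add_mono sum_mono gr_mono sub S_E min.mono) auto
    qed
    show "rk (X \<union> Y) + rk (X \<inter> Y) \<le> rk X + rk Y" for X Y
    proof -
      have "(\<Sum>c<k. gr (S c (X \<union> Y))) + (\<Sum>c<k. gr (S c (X \<inter> Y)))
          \<le> (\<Sum>c<k. gr (S c X)) + (\<Sum>c<k. gr (S c Y))"
        unfolding sum.distrib[symmetric] S_Un S_Int by (intro sum_mono gr_submod S_E)
      moreover have "min (card (S k (X \<union> Y))) s + min (card (S k (X \<inter> Y))) s
          \<le> min (card (S k X)) s + min (card (S k Y)) s"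
      proof -
        have "card (S k X) + card (S k Y) = card (S k X \<union> S k Y) + card (S k X \<inter> S k Y)"
          by (rule card_Un_Int[OF S_fin S_fin])
        moreover have "card (S k X \<inter> S k Y) \<le> card (S k X)" "card (S k X \<inter> S k Y) \<le> card (S k Y)"
          by (intro card_mono S_fin; simp)+
        ultimately show ?thesis unfolding S_Un S_Int by (simp add: min_def)
      qed
      ultimately show ?thesis unfolding rk_def by linarith
    qed
    show "card J \<le> rk (\<Union>e\<in>J. {e} \<times> {..k})" if "J \<subseteq> E" for J
    proof -
      have "S c (\<Union>e\<in>J. {e} \<times> {..k}) = J" if "c \<le> k" for c
        using that \<open>J \<subseteq> E\<close> by (auto simp: S_def)
      then have rkJ: "rk (\<Union>e\<in>J. {e} \<times> {..k}) = k * gr J + min (card J) s"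
        by (simp add: rk_def)
      \<comment> \<open>This is \<open>dense\<close> for \<open>J\<close>, rewritten with the
        definitions of \<open>gr\<close> and \<open>s\<close>. It settles Rado's condition when the
        minimum in \<open>rkJ\<close> is \<open>s\<close>; when it is \<open>card J\<close>, there
        is nothing to prove.\<close>
      have "card J \<le> k * gr J + s"
      proof -
        have "card J + k * (card (graph_components V J) - 1) \<le> card E"
          using dense[OF that] card_mono[OF finE that] that finE
          by (simp add: card_Diff_subset finite_subset)
        moreover have "k * (n - 1) = k * gr J + k * (card (graph_components V J) - 1)"
          unfolding gr_def using comps_le[of J] comps_ge[of J]
          by (simp add: distrib_left[symmetric])
        ultimately show ?thesis unfolding s_def by linarith
      qed
      then show ?thesis unfolding rkJ by (simp add: min_def)
    qed
  qed auto
  then obtain f where f: "\<forall>e\<in>E. f e \<in> {e} \<times> {..k}" "\<And>J. J \<subseteq> E \<Longrightarrow> card J \<le> rk (f ` J)"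
    by blast
  define F where "F c = {e \<in> E. snd (f e) = c}" for c
  have FE: "F c \<subseteq> E" for c by (auto simp: F_def)
  have fst_f: "fst (f e) = e" if "e \<in> E" for e using f(1) that by auto
  have S_F: "S c (f ` F b) = (if c = b then F b else {})" for b c
  proof -
    have "(e, c) \<in> f ` F b \<longleftrightarrow> e \<in> F b \<and> c = b" for e
    proof
      assume "(e, c) \<in> f ` F b"
      then obtain e' where "e' \<in> F b" "f e' = (e, c)" by auto
      then show "e \<in> F b \<and> c = b" using fst_f[of e'] by (auto simp: F_def)
    next
      assume "e \<in> F b \<and> c = b"
      then have "e \<in> F b" "f e = (e, c)" using fst_f[of e] by (auto simp: F_def prod_eq_iff)
      then show "(e, c) \<in> f ` F b" by force
    qed
    then show ?thesis using FE[of b] by (auto simp: S_def)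
  qed
  have F_le: "card (F c) \<le> gr (F c)" if "c < k" for c
    using f(2)[OF FE, of c] that by (simp add: rk_def S_F gr_empty if_distrib[of gr] cong: if_cong)
  have F_junk: "card (F k) \<le> s"
    using f(2)[OF FE, of k] by (simp add: rk_def S_F gr_empty)
  have gr_le: "gr (F c) \<le> n - 1" for c using comps_ge[of "F c"] by (simp add: gr_def)
  have "card E = (\<Sum>c\<le>k. card (F c))"
  proof -
    have "E = (\<Union>c\<le>k. F c)" using f(1) by (force simp: F_def)
    moreover have "card (\<Union>c\<le>k. F c) = (\<Sum>c\<le>k. card (F c))"
      using finE by (intro card_UN_disjoint) (auto simp: F_def)
    ultimately show ?thesis by simp
  qed
  then have "card E = (\<Sum>c<k. card (F c)) + card (F k)"
    by (simp add: lessThan_Suc_atMost[symmetric])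
  moreover have "k * (n - 1) \<le> card E" using dense[of "{}"] by (simp add: comps_empty)
  \<comment> \<open>The leftover class has at most \<open>s\<close> edges, so the other
    \<open>k\<close> classes have at least \<open>k * (n - 1)\<close> together. Each has rank at
    most \<open>n - 1\<close>, which forces equality in every class.\<close>
  ultimately have total: "k * (n - 1) \<le> (\<Sum>c<k. card (F c))"
    using F_junk unfolding s_def by linarith
  have conn: "connected_graph V (F c)" if "c < k" for c
  proof -
    have "\<not> gr (F c) < n - 1"
    proof
      assume "gr (F c) < n - 1"
      then have "(\<Sum>c<k. gr (F c)) < (\<Sum>c<k. n - 1)"
        using gr_le that by (intro sum_strict_mono_ex1) auto
      moreover have "(\<Sum>c<k. card (F c)) \<le> (\<Sum>c<k. gr (F c))" by (intro sum_mono F_le) auto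
      ultimately show False using total by simp
    qed
    then have "card (graph_components V (F c)) = 1"
      using comps_le[of "F c"] comps_ge[of "F c"] by (simp add: gr_def)
    then obtain C where "graph_components V (F c) = {C}" by (auto simp: card_1_singleton_iff)
    then have same: "graph_component V (F c) u = graph_component V (F c) v" if "u \<in> V" "v \<in> V" for u v
      using that unfolding graph_components_def by blast
    have "linked (F c) u v" if "u \<in> V" "v \<in> V" for u v
      using same[OF that] graph_component_eq_iff[OF that] by blast
    then show ?thesis using neV by (simp add: connected_graph_iff_linked)
  qed
  \<comment> \<open>The classes are already trees by the edge count, but passing to a spanning tree
    of each makes a separate proof of acyclicity unnecessary.\<close>
  have "\<forall>c<k. \<exists>T. T \<subseteq> F c \<and> tree_graph V T"
  proof (intro allI impI)
    fix c assume "c < k"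
    have "finite_simple_graph V (F c)" using graph FE[of c] by (auto simp: finite_simple_graph_def)
    then show "\<exists>T. T \<subseteq> F c \<and> tree_graph V T"
      using connected_graph_spanning_tree conn[OF \<open>c < k\<close>] by blast
  qed
  then obtain T where T: "\<And>c. c < k \<Longrightarrow> T c \<subseteq> F c \<and> tree_graph V (T c)" by metis
  have "disjoint_family_on T {..<k}"
    unfolding disjoint_family_on_def
  proof (intro ballI impI)
    fix i j assume "i \<in> {..<k}" "j \<in> {..<k}" "i \<noteq> j"
    then have "T i \<subseteq> F i" "T j \<subseteq> F j" "F i \<inter> F j = {}" using T by (auto simp: F_def)
    then show "T i \<inter> T j = {}" by blast
  qed
  moreover have "spanning_tree_of V E (T i)" if "i < k" for i
    using T[OF that] FE[of i] unfolding spanning_tree_of_def by blast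
  ultimately show ?thesis by blast
qed

section \<open>The second eigenvalue\<close>

text \<open>Vectors of dimension \<open>n\<close> are functions on \<open>nat\<close> with all
  coordinates from \<open>n\<close> on fixed at 0. The set is then a closed part of a product of
  compact sets, and Tychonoff's theorem applies.\<close>

lemma compact_unit_sphere_sum_zero:
  "compact {y :: nat \<Rightarrow> real. (\<forall>i\<ge>n. y i = 0) \<and> (\<Sum>i<n. y i) = 0 \<and> (\<Sum>i<n. (y i)\<^sup>2) = 1}"
    (is "compact ?K")
proof -
  let ?B = "PiE UNIV (\<lambda>i::nat. if i < n then {-1..1::real} else {0})"
  let ?L = "{y :: nat \<Rightarrow> real. (\<Sum>i<n. y i) = 0 \<and> (\<Sum>i<n. (y i)\<^sup>2) = 1}"
  have coord: "continuous_on UNIV (\<lambda>y :: nat \<Rightarrow> real. y i)" for i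
    by (rule continuous_on_product_coordinates)
  have "compactin (product_topology (\<lambda>i. euclidean) UNIV) ?B"
    by (subst compactin_PiE) (auto simp: compactin_euclidean_iff)
  then have "compact ?B" by (simp add: euclidean_product_topology compactin_euclidean_iff)
  moreover have "closed ?L"
    by (intro closed_Collect_conj closed_Collect_eq continuous_intros coord)
  ultimately have "compact (?B \<inter> ?L)" by (rule compact_Int_closed)
  moreover have "?B \<inter> ?L = ?K"
  proof -
    have "\<bar>y i\<bar> \<le> 1" if "(\<Sum>i<n. (y i)\<^sup>2) = 1" "i < n" for y :: "nat \<Rightarrow> real" and i
    proof -
      have "(y i)\<^sup>2 \<le> (\<Sum>i<n. (y i)\<^sup>2)" using that(2) by (intro member_le_sum) auto
      then show ?thesis using that(1) by (simp add: abs_square_le_1)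
    qed
    then show ?thesis by (fastforce simp: PiE_def Pi_def abs_le_iff split: if_splits)
  qed
  ultimately show ?thesis by simp
qed

text \<open>The quadratic form attains its maximum on the unit sphere of the hyperplane orthogonal
  to the vector of ones. The maximiser \<open>y\<close> is an eigenvector, and the maximum
  \<open>\<mu>\<close> is at least the Rayleigh quotient of \<open>x\<close>.\<close>

lemma symmetric_eigenvector_orthogonal_to_ones:
  fixes a :: "nat \<Rightarrow> nat \<Rightarrow> real" and x :: "nat \<Rightarrow> real"
  assumes sym: "\<And>i j. i < n \<Longrightarrow> j < n \<Longrightarrow> a i j = a j i"
    and row: "\<And>i. i < n \<Longrightarrow> (\<Sum>j<n. a i j) = d"
    and x0: "(\<Sum>i<n. x i) = 0" and xne: "\<exists>i<n. x i \<noteq> 0"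
    and xc: "c * (\<Sum>i<n. (x i)\<^sup>2) \<le> (\<Sum>i<n. \<Sum>j<n. a i j * x i * x j)"
  shows "\<exists>y \<mu>. c \<le> \<mu> \<and> (\<Sum>i<n. y i) = 0 \<and> (\<exists>i<n. y i \<noteq> 0) \<and>
    (\<forall>i<n. (\<Sum>j<n. a i j * y j) = \<mu> * y i)"
proof -
  define N where "N y = (\<Sum>i<n. (y i)\<^sup>2)" for y :: "nat \<Rightarrow> real"
  define Q where "Q y = (\<Sum>i<n. \<Sum>j<n. a i j * y i * y j)" for y :: "nat \<Rightarrow> real"
  define K where
    "K = {y :: nat \<Rightarrow> real. (\<forall>i\<ge>n. y i = 0) \<and> (\<Sum>i<n. y i) = 0 \<and> (\<Sum>i<n. (y i)\<^sup>2) = 1}"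
  have "compact K" unfolding K_def by (rule compact_unit_sphere_sum_zero)
  have Npos: "0 < N z" if "\<exists>i<n. z i \<noteq> 0" for z
    using that unfolding N_def by (auto intro!: sum_pos2)
  have normalised: "\<exists>w\<in>K. Q z = N z * Q w" if "(\<Sum>i<n. z i) = 0" "\<exists>i<n. z i \<noteq> 0" for z
  proof
    define r where "r = sqrt (N z)"
    have r: "r > 0" "r\<^sup>2 = N z" using Npos[OF that(2)] by (auto simp: r_def)
    let ?w = "\<lambda>i. if i < n then z i / r else 0"
    have "(\<Sum>i<n. (?w i)\<^sup>2) = (\<Sum>i<n. (z i)\<^sup>2) / r\<^sup>2"
      by (simp add: power_divide sum_divide_distrib)
    moreover have "(\<Sum>i<n. ?w i) = 0" using that(1) by (simp flip: sum_divide_distrib)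
    ultimately show "?w \<in> K" using r Npos[OF that(2)] by (simp add: N_def K_def)
    have "Q ?w = Q z / r\<^sup>2"
      by (simp add: Q_def sum_divide_distrib power2_eq_square)
    then show "Q z = N z * Q ?w" using r Npos[OF that(2)] by simp
  qed
  have "continuous_on K Q"
    unfolding Q_def
    by (intro continuous_intros continuous_on_subset[OF continuous_on_product_coordinates]) auto
  moreover have "K \<noteq> {}" using normalised[OF x0 xne] by auto
  ultimately obtain y where y: "y \<in> K" and ymax: "\<And>w. w \<in> K \<Longrightarrow> Q w \<le> Q y"
    using continuous_attains_sup[OF \<open>compact K\<close>] by metis
  define \<mu> where "\<mu> = Q y"
  have y0: "(\<Sum>i<n. y i) = 0" and Ny: "N y = 1" using y by (auto simp: N_def K_def)
  have Q_le: "Q z \<le> \<mu> * N z" if z0: "(\<Sum>i<n. z i) = 0" for z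
  proof (cases "\<exists>i<n. z i \<noteq> 0")
    case True
    then obtain w where "w \<in> K" "Q z = N z * Q w" using normalised[OF z0] by auto
    then show ?thesis
      using ymax[of w] Npos[OF True] by (simp add: \<mu>_def mult.commute)
  next
    case False
    then show ?thesis by (simp add: Q_def N_def)
  qed
  have "c * N x \<le> \<mu> * N x" using xc Q_le[OF x0] by (simp add: N_def Q_def)
  then have "c \<le> \<mu>" using Npos[OF xne] by simp
  \<comment> \<open>The residual of \<open>y\<close> as an eigenvector. Constant row sums and
    symmetry keep it in the hyperplane, so it is an admissible direction of variation.\<close>
  define g where "g i = (\<Sum>j<n. a i j * y j) - \<mu> * y i" for i
  have g0: "(\<Sum>i<n. g i) = 0"
  proof -
    have "(\<Sum>i<n. \<Sum>j<n. a i j * y j) = (\<Sum>j<n. \<Sum>i<n. a i j * y j)" by (rule sum.swap)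
    also have "\<dots> = (\<Sum>j<n. (\<Sum>i<n. a j i) * y j)"
      unfolding sum_distrib_right by (intro sum.cong refl) (simp add: sym)
    also have "\<dots> = 0" using y0 by (simp add: row flip: sum_distrib_left)
    finally show ?thesis using y0 by (simp add: g_def sum_subtractf flip: sum_distrib_left)
  qed
  define H where "H = Q g - \<mu> * N g"
  \<comment> \<open>Maximality, tested at \<open>y + t * g\<close>: the terms of order zero cancel
    because \<open>N y = 1\<close>, and the first-order coefficient is \<open>2 * N g\<close>
    because \<open>g\<close> is the residual.\<close>
  have perturb: "2 * t * N g + t\<^sup>2 * H \<le> 0" for t
  proof -
    let ?z = "\<lambda>i. y i + t * g i"
    have cross: "(\<Sum>i<n. \<Sum>j<n. a i j * y i * g j) = (\<Sum>i<n. \<Sum>j<n. a i j * g i * y j)"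
      by (subst sum.swap, intro sum.cong refl) (simp add: sym)
    have "Q ?z = Q y + t * (\<Sum>i<n. \<Sum>j<n. a i j * y i * g j)
        + t * (\<Sum>i<n. \<Sum>j<n. a i j * g i * y j) + t\<^sup>2 * Q g"
      unfolding Q_def by (simp add: algebra_simps sum.distrib sum_distrib_left power2_eq_square)
    then have Qz: "Q ?z = Q y + 2 * t * (\<Sum>i<n. \<Sum>j<n. a i j * g i * y j) + t\<^sup>2 * Q g"
      using cross by simp
    have Nz: "N ?z = N y + 2 * t * (\<Sum>i<n. g i * y i) + t\<^sup>2 * N g"
      unfolding N_def by (simp add: algebra_simps sum.distrib sum_distrib_left power2_eq_square)
    have "(\<Sum>i<n. \<Sum>j<n. a i j * g i * y j) - \<mu> * (\<Sum>i<n. g i * y i)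
        = (\<Sum>i<n. g i * ((\<Sum>j<n. a i j * y j) - \<mu> * y i))"
      by (simp add: algebra_simps sum_subtractf sum_distrib_left)
    also have "\<dots> = N g" unfolding N_def g_def[symmetric] by (simp add: power2_eq_square)
    finally have G: "(\<Sum>i<n. \<Sum>j<n. a i j * g i * y j) = N g + \<mu> * (\<Sum>i<n. g i * y i)" by simp
    have "(\<Sum>i<n. ?z i) = 0" using y0 g0 by (simp add: sum.distrib flip: sum_distrib_left)
    then have "Q ?z \<le> \<mu> * N ?z" by (rule Q_le)
    then show ?thesis unfolding Qz Nz G Ny H_def \<mu>_def[symmetric] by (simp add: algebra_simps)
  qed
  have "N g = 0"
  proof (rule ccontr)
    assume "N g \<noteq> 0"
    then have pos: "0 < N g" by (simp add: N_def order_less_le sum_nonneg)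
    \<comment> \<open>So small that the second-order term cannot cancel the first:
      \<open>t * \<bar>H\<bar> \<le> N g\<close>, hence \<open>2 * N g + t * H\<close> is at least
      \<open>N g\<close> and positive.\<close>
    define t where "t = N g / (\<bar>H\<bar> + 1)"
    have t: "0 < t" using pos by (simp add: t_def)
    have "2 * t * N g + t\<^sup>2 * H = t * (2 * N g + t * H)"
      by (simp add: algebra_simps power2_eq_square)
    then have "2 * N g + t * H \<le> 0" using perturb[of t] t by (simp add: mult_le_0_iff)
    moreover have "t * (\<bar>H\<bar> + 1) = N g" by (simp add: t_def)
    then have "- N g \<le> t * H" using t abs_ge_minus_self[of H]
      by (smt (verit) mult_left_mono mult_minus_right distrib_left mult_1_right)
    ultimately show False using pos by linarith
  qed
  then have "g i = 0" if "i < n" for i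
    using that by (simp add: N_def sum_nonneg_eq_0_iff)
  then have "\<forall>i<n. (\<Sum>j<n. a i j * y j) = \<mu> * y i" by (simp add: g_def)
  moreover have "\<exists>i<n. y i \<noteq> 0"
  proof (rule ccontr)
    assume "\<not> ?thesis"
    then have "N y = 0" by (simp add: N_def)
    then show False using Ny by simp
  qed
  ultimately show ?thesis using \<open>c \<le> \<mu>\<close> y0 by blast
qed

text \<open>
  Splitting off the eigenvector of ones by a similarity, instead of merely exhibiting two
  eigenvectors, counts the eigenvalue \<open>d\<close> with the right algebraic multiplicity.
\<close>

lemma char_poly_constant_row_sum:
  fixes A :: "real mat"
  assumes A: "A \<in> carrier_mat (Suc m) (Suc m)"
    and row: "\<And>i. i < Suc m \<Longrightarrow> (\<Sum>j<Suc m. A $$ (i, j)) = d"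
  shows "char_poly A =
    [:- d, 1:] * char_poly (mat m m (\<lambda>(i, j). A $$ (Suc i, Suc j) - A $$ (0, Suc j)))"
proof -
  let ?n = "Suc m"
  define A' where "A' = mat m m (\<lambda>(i, j). A $$ (Suc i, Suc j) - A $$ (0, Suc j))"
  define D where "D = mat 1 1 (\<lambda>_. d)"
  define R where "R = mat 1 m (\<lambda>(i, j). A $$ (0, Suc j))"
  define B where "B = four_block_mat D R (0\<^sub>m m 1) A'"
  \<comment> \<open>\<open>P\<close> replaces the first basis vector by the vector of ones, and
    \<open>P'\<close> is its inverse. In the new basis \<open>A\<close> becomes the block triangular
    \<open>B\<close>, with \<open>d\<close> in the corner and \<open>A'\<close> as its action modulo
    the vector of ones.\<close>
  define P where "P = mat ?n ?n (\<lambda>(i, j). if j = 0 \<or> i = j then 1 else 0 :: real)"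
  define P' where "P' = mat ?n ?n (\<lambda>(i, j). if i = j then 1 else if j = 0 then - 1 else 0 :: real)"
  have carr: "D \<in> carrier_mat 1 1" "R \<in> carrier_mat 1 m" "A' \<in> carrier_mat m m"
    "P \<in> carrier_mat ?n ?n" "P' \<in> carrier_mat ?n ?n"
    by (auto simp: D_def R_def A'_def P_def P'_def)
  have B: "B \<in> carrier_mat ?n ?n"
    using four_block_carrier_mat[OF carr(1,3)] by (simp add: B_def)
  have Bij: "B $$ (i, j) = (if i = 0 then if j = 0 then d else A $$ (0, j)
      else if j = 0 then 0 else A $$ (i, j) - A $$ (0, j))" if "i < ?n" "j < ?n" for i j
    using that carr unfolding B_def by (auto simp: D_def R_def A'_def)
  have prod: "(X * Y) $$ (i, j) = (\<Sum>k<?n. X $$ (i, k) * Y $$ (k, j))"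
    if "X \<in> carrier_mat ?n ?n" "Y \<in> carrier_mat ?n ?n" "i < ?n" "j < ?n" for X Y :: "real mat" and i j
    using that by (simp add: scalar_prod_def lessThan_atLeast0)
  have Pij: "P $$ (i, j) = (if j = 0 \<or> i = j then 1 else 0)"
    and P'ij: "P' $$ (i, j) = (if i = j then 1 else if j = 0 then - 1 else 0)"
    if "i < ?n" "j < ?n" for i j using that by (auto simp: P_def P'_def)
  have sumP: "(\<Sum>k<?n. P $$ (i, k) * f k) = (if i = 0 then f 0 else f 0 + f i)"
    if "i < ?n" for i and f :: "nat \<Rightarrow> real"
  proof -
    have "(\<Sum>k<?n. P $$ (i, k) * f k)
        = (\<Sum>k<?n. (if k = 0 then f k else 0) + (if k = i then if i = 0 then 0 else f k else 0))"
      using that by (intro sum.cong) (auto simp: Pij)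
    also have "\<dots> = (if i = 0 then f 0 else f 0 + f i)"
      using that by (simp add: sum.distrib)
    finally show ?thesis .
  qed
  have sumP': "(\<Sum>k<?n. P' $$ (i, k) * f k) = (if i = 0 then f 0 else f i - f 0)"
    if "i < ?n" for i and f :: "nat \<Rightarrow> real"
  proof -
    have "(\<Sum>k<?n. P' $$ (i, k) * f k)
        = (\<Sum>k<?n. (if k = i then f k else 0) - (if k = 0 then if i = 0 then 0 else f k else 0))"
      using that by (intro sum.cong) (auto simp: P'ij)
    also have "\<dots> = (if i = 0 then f 0 else f i - f 0)"
      using that by (simp add: sum_subtractf)
    finally show ?thesis .
  qed
  have PP': "P * P' = 1\<^sub>m ?n"
  proof (rule eq_matI)
    fix i j assume "i < dim_row (1\<^sub>m ?n :: real mat)" "j < dim_col (1\<^sub>m ?n :: real mat)"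
    then have ij: "i < ?n" "j < ?n" by auto
    show "(P * P') $$ (i, j) = 1\<^sub>m ?n $$ (i, j)"
      unfolding prod[OF carr(4,5) ij] sumP[OF ij(1)] using ij by (simp add: P'ij)
  qed (use carr in auto)
  have P'P: "P' * P = 1\<^sub>m ?n"
  proof (rule eq_matI)
    fix i j assume "i < dim_row (1\<^sub>m ?n :: real mat)" "j < dim_col (1\<^sub>m ?n :: real mat)"
    then have ij: "i < ?n" "j < ?n" by auto
    show "(P' * P) $$ (i, j) = 1\<^sub>m ?n $$ (i, j)"
      unfolding prod[OF carr(5,4) ij] sumP'[OF ij(1)] using ij by (simp add: Pij)
  qed (use carr in auto)
  have AP: "A * P = P * B"
  proof (rule eq_matI)
    fix i j assume "i < dim_row (P * B)" "j < dim_col (P * B)"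
    then have ij: "i < ?n" "j < ?n" using carr B by auto
    have "(A * P) $$ (i, j) = (\<Sum>k<?n. A $$ (i, k) * P $$ (k, j))"
      by (rule prod[OF A carr(4) ij])
    also have "\<dots> = (if j = 0 then d else A $$ (i, j))"
    proof (cases "j = 0")
      case True
      then have "(\<Sum>k<?n. A $$ (i, k) * P $$ (k, j)) = (\<Sum>k<?n. A $$ (i, k))"
        using ij by (intro sum.cong) (auto simp: Pij)
      then show ?thesis using True row[OF ij(1)] by simp
    next
      case False
      then have "(\<Sum>k<?n. A $$ (i, k) * P $$ (k, j)) = (\<Sum>k<?n. if k = j then A $$ (i, k) else 0)"
        using ij by (intro sum.cong) (auto simp: Pij)
      then show ?thesis using False ij by (simp del: sum.lessThan_Suc)
    qed
    also have "\<dots> = (P * B) $$ (i, j)"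
      unfolding prod[OF carr(4) B ij] sumP[OF ij(1)] using ij by (simp add: Bij)
    finally show "(A * P) $$ (i, j) = (P * B) $$ (i, j)" .
  qed (use A B carr in auto)
  have "A = A * (P * P')" using A by (simp add: PP')
  also have "\<dots> = A * P * P'" using A carr by (simp add: assoc_mult_mat)
  also have "\<dots> = P * B * P'" by (simp add: AP)
  finally have "similar_mat A B"
    unfolding similar_mat_def similar_mat_wit_def Let_def
    using A B carr PP' P'P by (intro exI[of _ P] exI[of _ P']) auto
  then have "char_poly A = char_poly B" by (rule char_poly_similar)
  also have "\<dots> = char_poly D * char_poly A'"
    unfolding B_def by (rule char_poly_four_block_zeros_col[OF carr(1-3)])
  also have "char_poly D = [:- d, 1:]"
    by (simp add: char_poly_defs D_def det_single)
  finally show ?thesis by (simp add: A'_def)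
qed

text \<open>If the second entry were below \<open>c\<close>, only the head of the list could reach
  \<open>c\<close>, leaving no room for both \<open>p\<close> and \<open>q\<close>. The multiset
  inclusion covers \<open>p = q\<close> as a double root.\<close>

lemma eigenvalues_desc_second_ge:
  assumes "c \<le> p" "c \<le> q" "{#p, q#} \<subseteq># proots (char_poly A)"
  shows "c \<le> eigenvalues_desc A ! 1"
proof (rule ccontr)
  define l where "l = eigenvalues_desc A"
  assume "\<not> ?thesis"
  then have less: "l ! 1 < c" by (simp add: l_def)
  have ms: "mset l = proots (char_poly A)" by (simp add: l_def eigenvalues_desc_def)
  have "sorted (rev l)" by (simp add: l_def eigenvalues_desc_def)
  have "size {#p, q#} \<le> size (mset l)" using assms(3) unfolding ms by (rule size_mset_mono)
  then have len: "2 \<le> length l" by simp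
  then obtain h k t where l: "l = h # k # t"
    by (metis One_nat_def Suc_1 Suc_le_length_iff)
  have "k < c" using less l by simp
  moreover have "\<forall>z\<in>set t. z \<le> k" using \<open>sorted (rev l)\<close> by (auto simp: l sorted_append)
  ultimately have "filter (\<lambda>z. c \<le> z) (k # t) = []" by (force simp: filter_empty_conv)
  then have "filter_mset (\<lambda>z. c \<le> z) (mset l) \<subseteq># {#h#}"
    by (simp add: l split: if_splits flip: mset_filter)
  moreover have "{#p, q#} \<subseteq># filter_mset (\<lambda>z. c \<le> z) (mset l)"
    using multiset_filter_mono[OF assms(3), of "\<lambda>z. c \<le> z"] assms(1,2) by (simp add: ms)
  ultimately have "{#p, q#} \<subseteq># {#h#}" by (rule subset_mset.trans[rotated])
  then show False using size_mset_mono by fastforce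
qed

text \<open>The eigenvector \<open>y\<close> orthogonal to the ones survives in the quotient by
  them, so \<open>\<mu>\<close> is a root of the second factor of the characteristic polynomial. It
  therefore counts in addition to \<open>d\<close>, even when \<open>\<mu> = d\<close>.\<close>

theorem second_eigenvalue_ge_rayleigh:
  fixes A :: "real mat"
  assumes A: "A \<in> carrier_mat n n"
    and sym: "\<And>i j. i < n \<Longrightarrow> j < n \<Longrightarrow> A $$ (i, j) = A $$ (j, i)"
    and row: "\<And>i. i < n \<Longrightarrow> (\<Sum>j<n. A $$ (i, j)) = d" and "c \<le> d"
    and x: "(\<Sum>i<n. x i) = 0" "\<exists>i<n. x i \<noteq> 0"
    and xc: "c * (\<Sum>i<n. (x i)\<^sup>2) \<le> (\<Sum>i<n. \<Sum>j<n. A $$ (i, j) * x i * x j)"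
  shows "c \<le> eigenvalues_desc A ! 1"
proof -
  obtain m where n: "n = Suc m" using x(2) by (cases n) auto
  obtain y \<mu> where \<mu>: "c \<le> \<mu>" and y0: "(\<Sum>i<n. y i) = 0" and yne: "\<exists>i<n. y i \<noteq> 0"
    and ev: "\<And>i. i < n \<Longrightarrow> (\<Sum>j<n. A $$ (i, j) * y j) = \<mu> * y i"
    using symmetric_eigenvector_orthogonal_to_ones[of n "\<lambda>i j. A $$ (i, j)" d x c] sym row x xc
    by blast
  define A' where "A' = mat m m (\<lambda>(i, j). A $$ (Suc i, Suc j) - A $$ (0, Suc j))"
  have A': "A' \<in> carrier_mat m m" by (simp add: A'_def)
  have cp: "char_poly A = [:- d, 1:] * char_poly A'"
    unfolding A'_def using char_poly_constant_row_sum[of A m d] A row n by simp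
  \<comment> \<open>The coordinates of \<open>y\<close> modulo the vector of ones.\<close>
  define v where "v = vec m (\<lambda>i. y (Suc i) - y 0)"
  have "v \<noteq> 0\<^sub>v m"
  proof
    assume v: "v = 0\<^sub>v m"
    have const: "y i = y 0" if "i < n" for i
    proof (cases i)
      case (Suc k)
      then have "v $ k = 0" using that n v by simp
      then show ?thesis using that n Suc by (simp add: v_def)
    qed simp
    have "(\<Sum>i<n. y i) = (\<Sum>i<n. y 0)" by (rule sum.cong[OF refl], rule const) simp
    then have "y 0 = 0" using y0 n by simp
    moreover obtain i where "i < n" "y i \<noteq> 0" using yne by blast
    ultimately show False using const[of i] by simp
  qed
  moreover have "A' *\<^sub>v v = \<mu> \<cdot>\<^sub>v v"
  proof (rule eq_vecI)
    fix i assume "i < dim_vec (\<mu> \<cdot>\<^sub>v v)"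
    then have i: "i < m" by (simp add: v_def)
    have "(A' *\<^sub>v v) $ i = (\<Sum>j<m. (A $$ (Suc i, Suc j) - A $$ (0, Suc j)) * (y (Suc j) - y 0))"
      using i by (simp add: A'_def v_def scalar_prod_def lessThan_atLeast0)
    \<comment> \<open>The added term for \<open>j = 0\<close> vanishes since its factor is
      \<open>y 0 - y 0\<close>.\<close>
    also have "\<dots> = (\<Sum>j<n. (A $$ (Suc i, j) - A $$ (0, j)) * (y j - y 0))"
      unfolding n sum.lessThan_Suc_shift by simp
    also have "\<dots> = (\<Sum>j<n. A $$ (Suc i, j) * y j) - (\<Sum>j<n. A $$ (0, j) * y j)
        - ((\<Sum>j<n. A $$ (Suc i, j)) - (\<Sum>j<n. A $$ (0, j))) * y 0"
      by (simp add: algebra_simps sum_subtractf sum.distrib sum_distrib_left)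
    also have "\<dots> = \<mu> * (y (Suc i) - y 0)"
      using i n ev[of 0] ev[of "Suc i"] row[of 0] row[of "Suc i"] by (simp add: algebra_simps del: sum.lessThan_Suc)
    finally show "(A' *\<^sub>v v) $ i = (\<mu> \<cdot>\<^sub>v v) $ i" using i by (simp add: v_def)
  qed (simp add: A'_def v_def)
  ultimately have "eigenvalue A' \<mu>"
    unfolding eigenvalue_def eigenvector_def using A' by (intro exI[of _ v]) (auto simp: v_def)
  then have root: "poly (char_poly A') \<mu> = 0" using eigenvalue_root_char_poly[OF A'] by simp
  have ne: "char_poly A' \<noteq> 0" using degree_monic_char_poly[OF A'] by auto
  then have "proots (char_poly A) = {#d#} + proots (char_poly A')"
    unfolding cp by (subst proots_mult) auto
  moreover have "\<mu> \<in># proots (char_poly A')" using root ne by simp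
  ultimately have "{#d, \<mu>#} \<subseteq># proots (char_poly A)" by simp
  then show ?thesis using eigenvalues_desc_second_ge \<open>c \<le> d\<close> \<mu> by blast
qed

section \<open>Sparse cuts of regular graphs\<close>

text \<open>Ordered pairs are counted, so an edge inside \<open>X \<inter> Y\<close> counts twice.\<close>

definition edges_between :: "'a set set \<Rightarrow> 'a set \<Rightarrow> 'a set \<Rightarrow> nat" where
  "edges_between E X Y = (\<Sum>u\<in>X. \<Sum>v\<in>Y. of_bool ({u, v} \<in> E))"

lemma edges_between_mono:
  assumes "finite Z" "Y \<subseteq> Z"
  shows "edges_between E X Y \<le> edges_between E X Z"
  unfolding edges_between_def by (intro sum_mono sum_mono2) (use assms in auto)

lemma edges_between_sym: "edges_between E X Y = edges_between E Y X"
  unfolding edges_between_def by (subst sum.swap) (simp add: insert_commute)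

lemma edges_between_Union:
  assumes "\<forall>D\<in>F. finite D" "\<forall>C\<in>F. \<forall>D\<in>F. C \<noteq> D \<longrightarrow> C \<inter> D = {}"
  shows "edges_between E X (\<Union>F) = (\<Sum>D\<in>F. edges_between E X D)"
proof -
  have "edges_between E X (\<Union>F) = (\<Sum>u\<in>X. \<Sum>D\<in>F. \<Sum>v\<in>D. of_bool ({u, v} \<in> E))"
    unfolding edges_between_def sum.Union_disjoint[OF assms] comp_def by (rule refl)
  also have "\<dots> = (\<Sum>D\<in>F. \<Sum>u\<in>X. \<Sum>v\<in>D. of_bool ({u, v} \<in> E))" by (rule sum.swap)
  finally show ?thesis by (simp only: edges_between_def)
qed

lemma edges_between_eq_card:
  assumes "finite X" "finite Y"
  shows "edges_between E X Y = card {(u, v). u \<in> X \<and> v \<in> Y \<and> {u, v} \<in> E}"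
proof -
  have "edges_between E X Y = (\<Sum>u\<in>X. card {v \<in> Y. {u, v} \<in> E})"
    unfolding edges_between_def using assms(2)
    by (simp add: of_bool_def sum.If_cases Int_def)
  also have "\<dots> = card (SIGMA u:X. {v \<in> Y. {u, v} \<in> E})"
    using assms by (simp add: card_SigmaI)
  also have "(SIGMA u:X. {v \<in> Y. {u, v} \<in> E}) = {(u, v). u \<in> X \<and> v \<in> Y \<and> {u, v} \<in> E}" by auto
  finally show ?thesis .
qed

lemma no_loop:
  assumes "finite_simple_graph V E"
  shows "{u, u} \<notin> E"
proof
  assume "{u, u} \<in> E"
  then obtain x y where "x \<noteq> y" "{u, u} = {x, y}"
    using assms unfolding finite_simple_graph_def by blast
  then show False by (auto simp: doubleton_eq_iff)
qed

lemma sum_adjacent_eq_degree: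
  assumes graph: "finite_simple_graph V E" and reg: "regular_graph V E d" and u: "u \<in> V"
  shows "(\<Sum>v\<in>V. of_bool ({u, v} \<in> E)) = d"
proof -
  have fin: "finite V" using graph by (simp add: finite_simple_graph_def)
  have "(\<Sum>v\<in>V. of_bool ({u, v} \<in> E)) = card {v \<in> V. {u, v} \<in> E}"
    using fin by (simp add: of_bool_def sum.If_cases Int_def)
  also have "\<dots> = card ((\<lambda>v. {u, v}) ` {v \<in> V. {u, v} \<in> E})"
    by (rule card_image[symmetric]) (auto simp: inj_on_def doubleton_eq_iff)
  also have "(\<lambda>v. {u, v}) ` {v \<in> V. {u, v} \<in> E} = {e \<in> E. u \<in> e}"
  proof (intro Set.equalityI subsetI)
    fix e assume e: "e \<in> {e \<in> E. u \<in> e}"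
    then obtain x y where "x \<in> V" "y \<in> V" "e = {x, y}"
      using graph unfolding finite_simple_graph_def by blast
    then obtain v where "v \<in> V" "e = {u, v}" using e by (auto simp: insert_commute)
    then show "e \<in> (\<lambda>v. {u, v}) ` {v \<in> V. {u, v} \<in> E}" using e by blast
  qed auto
  finally show ?thesis using reg u by (simp add: regular_graph_def degree_in_def)
qed

lemma edges_between_complement:
  assumes graph: "finite_simple_graph V E" and reg: "regular_graph V E d" and C: "C \<subseteq> V"
  shows "edges_between E C C + edges_between E C (V - C) = d * card C"
proof -
  have fin: "finite V" using graph by (simp add: finite_simple_graph_def)
  have "edges_between E C C + edges_between E C (V - C) = (\<Sum>u\<in>C. \<Sum>v\<in>V. of_bool ({u, v} \<in> E))"
    unfolding edges_between_def sum.distrib[symmetric]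
    by (intro sum.cong refl) (metis sum.subset_diff[OF C fin] add.commute)
  also have "\<dots> = (\<Sum>u\<in>C. d)"
    using C by (intro sum.cong refl sum_adjacent_eq_degree[OF graph reg]) auto
  finally show ?thesis by simp
qed

text \<open>A vertex of \<open>C\<close> has at most \<open>card C - 1\<close> neighbours inside. If
  \<open>card C \<le> d\<close>, at least \<open>card C * (d + 1 - card C)\<close> edges leave
  \<open>C\<close>, and this is at least \<open>d\<close> for
  \<open>1 \<le> card C \<le> d\<close>.\<close>

lemma small_cut_imp_large_part:
  assumes graph: "finite_simple_graph V E" and reg: "regular_graph V E d"
    and C: "C \<subseteq> V" "C \<noteq> {}" and cut: "edges_between E C (V - C) < d"
  shows "d + 1 \<le> card C"
proof (rule ccontr)
  assume "\<not> ?thesis"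
  then have le: "card C \<le> d" by simp
  have fin: "finite C" using graph C(1) by (meson finite_simple_graph_def finite_subset)
  then have pos: "1 \<le> card C" using C(2) by (simp add: Suc_le_eq card_gt_0_iff)
  have "(\<Sum>v\<in>C. of_bool ({u, v} \<in> E)) \<le> card C - 1" if "u \<in> C" for u
  proof -
    have "(\<Sum>v\<in>C. of_bool ({u, v} \<in> E)) = card {v \<in> C. {u, v} \<in> E}"
      using fin by (simp add: of_bool_def sum.If_cases Int_def)
    also have "\<dots> \<le> card (C - {u})"
      using fin no_loop[OF graph, of u] by (intro card_mono) auto
    finally show ?thesis using that fin by simp
  qed
  then have "edges_between E C C \<le> (\<Sum>u\<in>C. card C - 1)"
    unfolding edges_between_def by (rule sum_mono)
  then have "d * card C < card C * (card C - 1) + d"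
    using edges_between_complement[OF graph reg C(1)] cut by simp
  moreover obtain m where m: "card C = Suc m" using pos by (cases "card C") auto
  moreover obtain j where "d = Suc m + j" using le m by (metis le_iff_add)
  ultimately show False by (simp add: algebra_simps)
qed

section \<open>Rayleigh quotient of a vector supported on two parts\<close>

lemma sum_mult_indicator:
  fixes f :: "'a \<Rightarrow> real"
  assumes "finite V" "Y \<subseteq> V"
  shows "(\<Sum>v\<in>V. f v * of_bool (v \<in> Y)) = (\<Sum>v\<in>Y. f v)"
  using assms by (intro sum.mono_neutral_cong_right) auto

lemma quadratic_form_indicators:
  assumes "finite V" "X \<subseteq> V" "Y \<subseteq> V"
  shows "(\<Sum>u\<in>V. \<Sum>v\<in>V. of_bool ({u, v} \<in> E) * of_bool (u \<in> X) * of_bool (v \<in> Y))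
    = real (edges_between E X Y)"
proof -
  have "(\<Sum>u\<in>V. \<Sum>v\<in>V. of_bool ({u, v} \<in> E) * of_bool (u \<in> X) * of_bool (v \<in> Y))
      = (\<Sum>u\<in>V. \<Sum>v\<in>Y. of_bool ({u, v} \<in> E) * (of_bool (u \<in> X) :: real))"
    by (intro sum.cong refl sum_mult_indicator assms)
  also have "\<dots> = (\<Sum>u\<in>V. (\<Sum>v\<in>Y. of_bool ({u, v} \<in> E)) * of_bool (u \<in> X))"
    by (simp add: sum_distrib_right)
  also have "\<dots> = (\<Sum>u\<in>X. \<Sum>v\<in>Y. of_bool ({u, v} \<in> E))"
    by (intro sum_mult_indicator assms)
  finally show ?thesis by (simp add: edges_between_def)
qed

text \<open>Bounds the loss in the quadratic form, with \<open>p\<close>, \<open>q\<close> the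
  reciprocal part sizes and \<open>s = 1 / (d + 1)\<close>. By symmetry let \<open>q\<close> be the
  smaller, with \<open>r1\<close> attached to it as in case \<open>le\<close>. Eliminating
  \<open>e\<close> leaves \<open>10 * p * q - r1 * q * (p - q) + r2 * p * (p - q)\<close>, which is
  largest at \<open>r1 = 0\<close>, \<open>r2 = 5\<close>, with value
  \<open>5 * p * (p + q)\<close>.\<close>

lemma two_part_inequality:
  fixes p q s r1 r2 e :: real
  assumes "0 \<le> p" "p \<le> s" "0 \<le> q" "q \<le> s" "0 \<le> r1" "r1 \<le> 5" "0 \<le> r2" "r2 \<le> 5"
    and sum: "r1 + r2 + 2 * e \<le> 10"
  shows "r1 * p\<^sup>2 + r2 * q\<^sup>2 + 2 * e * p * q \<le> 5 * s * (p + q)"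
  using assms(1-8) sum
proof (induction p q arbitrary: r1 r2 rule: linorder_wlog)
  case (le q p)
  have "2 * e * (p * q) \<le> (10 - r1 - r2) * (p * q)"
    using le by (intro mult_right_mono) auto
  moreover have "r2 * (p * (p - q)) \<le> 5 * (p * (p - q))" using le by (intro mult_right_mono) auto
  moreover have "0 \<le> r1 * (q * (p - q))" using le by simp
  moreover have "5 * p * (p + q) \<le> 5 * s * (p + q)" using le by (intro mult_right_mono) auto
  ultimately show ?case by (simp add: algebra_simps power2_eq_square)
next
  case (sym q p)
  from sym(1)[of r2 r1] sym(2-) show ?case by (simp add: algebra_simps)
qed

lemma second_eigenvalue_ge_two_parts:
  assumes graph: "finite_simple_graph V E" and reg: "regular_graph V E d"
    and vs: "distinct vs" "set vs = V"
    and parts: "C \<subseteq> V" "D \<subseteq> V" "C \<inter> D = {}" "d + 1 \<le> card C" "d + 1 \<le> card D"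
    and cuts: "edges_between E C (V - C) \<le> 5" "edges_between E D (V - D) \<le> 5"
      "edges_between E C (V - C) + edges_between E D (V - D) + 2 * edges_between E C D \<le> 10"
  shows "real d - 5 / (real d + 1) \<le> adj_eigenvalue vs E 2"
proof -
  let ?n = "length vs" and ?A = "adjacency_matrix vs E"
  define a :: "'a \<Rightarrow> 'a \<Rightarrow> real" where "a u v = of_bool ({u, v} \<in> E)" for u v
  define p where "p = 1 / real (card C)"
  define q where "q = 1 / real (card D)"
  \<comment> \<open>The scaling \<open>p * card C = 1 = q * card D\<close> makes the entries sum to
    0 and the squared norm equal to \<open>p + q\<close>.\<close>
  define g where "g v = p * of_bool (v \<in> C) - q * of_bool (v \<in> D)" for v
  let ?c = "real d - 5 / (real d + 1)"
  have fin: "finite V" using graph by (simp add: finite_simple_graph_def)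
  have pos: "0 < p" "0 < q" and pC: "p * card C = 1" and qD: "q * card D = 1"
    using parts by (auto simp: p_def q_def)
  have ple: "p \<le> 1 / (real d + 1)" "q \<le> 1 / (real d + 1)"
    unfolding p_def q_def using parts(4,5) by (auto intro!: divide_left_mono)
  have reindex: "(\<Sum>i<?n. h (vs ! i)) = (\<Sum>v\<in>V. h v)" for h :: "'a \<Rightarrow> real"
    using sum.reindex_bij_betw[OF bij_betw_nth[OF vs(1) refl refl], of h] vs(2) by simp
  have Aij: "?A $$ (i, j) = a (vs ! i) (vs ! j)" if "i < ?n" "j < ?n" for i j
    using that by (simp add: adjacency_matrix_def a_def)
  have sum_g: "(\<Sum>v\<in>V. h v * g v) = p * (\<Sum>v\<in>C. h v) - q * (\<Sum>v\<in>D. h v)" for h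
  proof -
    have "(\<Sum>v\<in>V. h v * g v)
        = p * (\<Sum>v\<in>V. h v * of_bool (v \<in> C)) - q * (\<Sum>v\<in>V. h v * of_bool (v \<in> D))"
      by (simp add: g_def algebra_simps sum_subtractf sum_distrib_left)
    then show ?thesis using sum_mult_indicator[OF fin parts(1)] sum_mult_indicator[OF fin parts(2)]
      by simp
  qed
  have g_C: "g v = p" if "v \<in> C" for v using that parts(3) by (auto simp: g_def)
  have g_D: "g v = - q" if "v \<in> D" for v using that parts(3) by (auto simp: g_def)
  have g_sum: "(\<Sum>v\<in>V. g v) = 0" using sum_g[of "\<lambda>_. 1"] pC qD by simp
  have g_norm: "(\<Sum>v\<in>V. (g v)\<^sup>2) = p + q"
  proof -
    have "(\<Sum>v\<in>V. (g v)\<^sup>2) = p * (\<Sum>v\<in>C. g v) - q * (\<Sum>v\<in>D. g v)"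
      using sum_g[of g] by (simp add: power2_eq_square)
    also have "\<dots> = p * (p * card C) + q * (q * card D)" by (simp add: g_C g_D)
    finally show ?thesis using pC qD by simp
  qed
  have "C \<noteq> {}" using parts(4) by auto
  then obtain u where "u \<in> C" by auto
  then obtain i where "i < ?n" "vs ! i = u" using parts(1) vs(2) by (metis in_set_conv_nth subsetD)
  then have nonzero: "\<exists>i<?n. g (vs ! i) \<noteq> 0" using g_C[OF \<open>u \<in> C\<close>] pos by auto
  have EC: "real (edges_between E C C) = real d * real (card C) - real (edges_between E C (V - C))"
    and ED: "real (edges_between E D D) = real d * real (card D) - real (edges_between E D (V - D))"
    using edges_between_complement[OF graph reg parts(1)] edges_between_complement[OF graph reg parts(2)]
    by (simp_all flip: of_nat_mult of_nat_add add: eq_diff_eq)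
  have "(\<Sum>u\<in>V. \<Sum>v\<in>V. a u v * g u * g v)
      = p\<^sup>2 * (\<Sum>u\<in>V. \<Sum>v\<in>V. a u v * of_bool (u \<in> C) * of_bool (v \<in> C))
      - p * q * (\<Sum>u\<in>V. \<Sum>v\<in>V. a u v * of_bool (u \<in> C) * of_bool (v \<in> D))
      - p * q * (\<Sum>u\<in>V. \<Sum>v\<in>V. a u v * of_bool (u \<in> D) * of_bool (v \<in> C))
      + q\<^sup>2 * (\<Sum>u\<in>V. \<Sum>v\<in>V. a u v * of_bool (u \<in> D) * of_bool (v \<in> D))"
    unfolding g_def sum_distrib_left sum_subtractf[symmetric] sum.distrib[symmetric]
    by (intro sum.cong refl) (simp add: algebra_simps power2_eq_square)
  also have "\<dots> = p\<^sup>2 * edges_between E C C - 2 * p * q * edges_between E C D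
      + q\<^sup>2 * edges_between E D D"
    unfolding a_def quadratic_form_indicators[OF fin parts(1,1)] quadratic_form_indicators[OF fin parts(1,2)]
      quadratic_form_indicators[OF fin parts(2,1)] quadratic_form_indicators[OF fin parts(2,2)]
      edges_between_sym[of E D C] by simp
  \<comment> \<open>Regularity trades the edges inside each part for the edges leaving it: the form
    is \<open>d * (p + q)\<close> minus a loss that depends only on the cuts.\<close>
  also have "\<dots> = d * (p * (p * card C) + q * (q * card D)) - (edges_between E C (V - C) * p\<^sup>2
      + edges_between E D (V - D) * q\<^sup>2 + 2 * real (edges_between E C D) * p * q)"
    unfolding EC ED by (simp add: algebra_simps power2_eq_square)
  also have "\<dots> \<ge> d * (p + q) - 5 * (1 / (real d + 1)) * (p + q)"
  proof -
    have "edges_between E C (V - C) * p\<^sup>2 + edges_between E D (V - D) * q\<^sup>2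
        + 2 * real (edges_between E C D) * p * q \<le> 5 * (1 / (real d + 1)) * (p + q)"
      using pos ple cuts by (intro two_part_inequality) linarith+
    then show ?thesis using pC qD by simp
  qed
  finally have form: "?c * (p + q) \<le> (\<Sum>u\<in>V. \<Sum>v\<in>V. a u v * g u * g v)"
    by (simp add: algebra_simps)
  have "?c \<le> eigenvalues_desc ?A ! 1"
  proof (rule second_eigenvalue_ge_rayleigh[where n = ?n and d = d and x = "\<lambda>i. g (vs ! i)"])
    show "?A \<in> carrier_mat ?n ?n" by (simp add: adjacency_matrix_def)
    show "?A $$ (i, j) = ?A $$ (j, i)" if "i < ?n" "j < ?n" for i j
      using that by (simp add: Aij a_def insert_commute)
    show "(\<Sum>j<?n. ?A $$ (i, j)) = real d" if "i < ?n" for i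
    proof -
      have "(\<Sum>j<?n. ?A $$ (i, j)) = (\<Sum>v\<in>V. a (vs ! i) v)"
        using that by (simp add: Aij flip: reindex)
      also have "\<dots> = real (\<Sum>v\<in>V. of_bool ({vs ! i, v} \<in> E))" by (simp add: a_def)
      also have "\<dots> = d" using that vs(2) sum_adjacent_eq_degree[OF graph reg, of "vs ! i"] by auto
      finally show ?thesis .
    qed
    show "(\<Sum>i<?n. g (vs ! i)) = 0" using reindex[of g] g_sum by simp
    show "\<exists>i<?n. g (vs ! i) \<noteq> 0" by (rule nonzero)
    have "(\<Sum>i<?n. \<Sum>j<?n. ?A $$ (i, j) * g (vs ! i) * g (vs ! j))
        = (\<Sum>u\<in>V. \<Sum>v\<in>V. a u v * g u * g v)"
      by (simp add: Aij flip: reindex)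
    then show "?c * (\<Sum>i<?n. (g (vs ! i))\<^sup>2)
        \<le> (\<Sum>i<?n. \<Sum>j<?n. ?A $$ (i, j) * g (vs ! i) * g (vs ! j))"
      using form g_norm reindex[of "\<lambda>v. (g v)\<^sup>2"] by simp
  qed simp
  then show ?thesis by (simp add: adj_eigenvalue_def)
qed

section \<open>Two components with small cuts\<close>

text \<open>An edge leaving a component of \<open>J\<close> is not in \<open>J\<close>. Ordered
  pairs recorded at different components differ in their first entry, so the counts add up, and
  every edge outside \<open>J\<close> supplies at most its two orientations.\<close>

lemma sum_component_cuts_le:
  assumes graph: "finite_simple_graph V E" and J: "J \<subseteq> E"
  shows "(\<Sum>C\<in>graph_components V J. edges_between E C (V - C)) \<le> 2 * card (E - J)"
proof -
  have fin: "finite V" using graph by (simp add: finite_simple_graph_def)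
  have finE: "finite E" using finite_simple_graph_finite_edges[OF graph] .
  let ?W = "\<lambda>C. {(u, v). u \<in> C \<and> v \<in> V - C \<and> {u, v} \<in> E}"
  have sub: "C \<subseteq> V" if "C \<in> graph_components V J" for C
    using that by (auto simp: graph_components_def graph_component_def)
  have finW: "finite (?W C)" if "C \<in> graph_components V J" for C
    by (rule finite_subset[of _ "V \<times> V"]) (use fin sub[OF that] in auto)
  have pairs: "\<exists>x y. {(u, v). {u, v} = e} = {(x, y), (y, x)}" if "e \<in> E - J" for e
  proof -
    have "\<exists>u\<in>V. \<exists>v\<in>V. u \<noteq> v \<and> e = {u, v}"
      using that graph by (simp add: finite_simple_graph_def)
    then obtain x y where "e = {x, y}" by blast
    then have "{(u, v). {u, v} = e} = {(x, y), (y, x)}" by (auto simp: doubleton_eq_iff)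
    then show ?thesis by blast
  qed
  have crossing: "{u, v} \<notin> J" if C: "C \<in> graph_components V J" and "u \<in> C" "v \<in> V - C" for C u v
  proof
    assume "{u, v} \<in> J"
    then have "linked J u v" by (rule linked_edge)
    moreover obtain x where "C = graph_component V J x" using C by (auto simp: graph_components_def)
    ultimately show False using that linked_trans[of J x u v] by (auto simp: graph_component_def)
  qed
  have "(\<Sum>C\<in>graph_components V J. edges_between E C (V - C)) = (\<Sum>C\<in>graph_components V J. card (?W C))"
  proof (intro sum.cong refl edges_between_eq_card)
    fix C assume "C \<in> graph_components V J"
    then show "finite C" using sub fin finite_subset by blast
  qed (use fin in simp)
  also have "\<dots> = card (\<Union>C\<in>graph_components V J. ?W C)"
  proof (intro card_UN_disjoint[symmetric] ballI impI)
    fix C D assume CD: "C \<in> graph_components V J" "D \<in> graph_components V J" "C \<noteq> D"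
    have "C \<inter> D = {}" using graph_components_disjoint[OF CD] .
    then show "?W C \<inter> ?W D = {}" by auto
  qed (use finite_components[OF fin] finW in auto)
  also have "\<dots> \<le> card (\<Union>e\<in>E - J. {(u, v). {u, v} = e})"
  proof (rule card_mono)
    show "finite (\<Union>e\<in>E - J. {(u, v). {u, v} = e})"
      using finE
    proof (intro finite_UN_I)
      fix e assume "e \<in> E - J"
      from pairs[OF this] obtain x y where "{(u, v). {u, v} = e} = {(x, y), (y, x)}" by (elim exE)
      then show "finite {(u, v). {u, v} = e}" by simp
    qed simp
    show "(\<Union>C\<in>graph_components V J. ?W C) \<subseteq> (\<Union>e\<in>E - J. {(u, v). {u, v} = e})"
    proof clarify
      fix C u v assume "C \<in> graph_components V J" "u \<in> C" "v \<in> V" "v \<notin> C" "{u, v} \<in> E"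
      then have "{u, v} \<in> E - J" using crossing by simp
      then show "(u, v) \<in> (\<Union>e\<in>E - J. {(u, v). {u, v} = e})" by blast
    qed
  qed
  also have "\<dots> \<le> (\<Sum>e\<in>E - J. card {(u, v). {u, v} = e})"
    using finE by (intro card_UN_le) simp
  also have "\<dots> \<le> (\<Sum>e\<in>E - J. 2)"
  proof (rule sum_mono)
    fix e assume "e \<in> E - J"
    from pairs[OF this] obtain x y where "{(u, v). {u, v} = e} = {(x, y), (y, x)}" by (elim exE)
    moreover have "card {(x, y), (y, x)} \<le> 2" by (cases "x = y") auto
    ultimately show "card {(u, v). {u, v} = e} \<le> 2" by (simp only:)
  qed
  finally show ?thesis by simp
qed

text \<open>Here \<open>r\<close> stands for the cut sizes and \<open>m\<close> for the edges
  between parts. Parts with \<open>r C \<ge> 6\<close> contribute nothing positive to the sum of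
  \<open>6 - r C\<close>, so the parts with \<open>r C \<le> 5\<close> alone carry the surplus 8.
  Integers are used because \<open>6 - r C\<close> may be negative.\<close>

lemma exists_sparse_pair:
  fixes r :: "'b \<Rightarrow> nat" and m :: "'b \<Rightarrow> 'b \<Rightarrow> nat"
  assumes fin: "finite P" and total: "(\<Sum>C\<in>P. r C) + 8 \<le> 6 * card P"
    and cut: "\<And>C L. C \<in> P \<Longrightarrow> L \<subseteq> P - {C} \<Longrightarrow> (\<Sum>D\<in>L. m C D) \<le> r C"
  shows "\<exists>C\<in>P. \<exists>D\<in>P. C \<noteq> D \<and> r C \<le> 5 \<and> r D \<le> 5 \<and> r C + r D + 2 * m C D \<le> 10"
proof (rule ccontr)
  assume no: "\<not> ?thesis"
  define L where "L = {C \<in> P. r C \<le> 5}"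
  have finL: "finite L" and LP: "L \<subseteq> P" using fin by (auto simp: L_def)
  have "(\<Sum>C\<in>P. 6 - int (r C)) \<le> (\<Sum>C\<in>L. 6 - int (r C))"
    using fin LP by (subst sum.subset_diff[OF LP fin]) (auto simp: L_def intro!: sum_nonpos)
  moreover have "(\<Sum>C\<in>P. 6 - int (r C)) = 6 * int (card P) - int (\<Sum>C\<in>P. r C)"
    by (simp add: sum_subtractf)
  ultimately have excess: "8 \<le> (\<Sum>C\<in>L. 6 - int (r C))" using total by linarith
  then have "L \<noteq> {}" by auto
  \<comment> \<open>If every pair fails, the sparsest part \<open>C\<close> sends at least \<open>6 - r D\<close> edges to each other
    sparse part \<open>D\<close>, hence at least \<open>8 - (6 - r C) > r C\<close> edges in total.\<close>
  then obtain C where C: "C \<in> L" and least: "\<And>D. D \<in> L \<Longrightarrow> r C \<le> r D"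
    using ex_min_if_finite[of "r ` L"] finL by (metis (no_types, lifting) arg_min_if_finite linorder_not_le)
  have "6 - int (r D) \<le> int (m C D)" if D: "D \<in> L - {C}" for D
  proof -
    \<comment> \<open>With \<open>r C \<le> r D\<close> this gives
      \<open>2 * m C D \<ge> 11 - 2 * r D\<close>, and integrality rounds up to
      \<open>m C D \<ge> 6 - r D\<close>.\<close>
    have "10 < r C + r D + 2 * m C D" using no C D by (force simp: L_def)
    then show ?thesis using least[of D] D by auto
  qed
  then have "(\<Sum>D\<in>L - {C}. 6 - int (r D)) \<le> (\<Sum>D\<in>L - {C}. int (m C D))" by (rule sum_mono)
  also have "\<dots> \<le> int (r C)" using cut[of C "L - {C}"] C LP by (auto simp flip: of_nat_sum)
  finally show False using excess sum.remove[OF finL C, of "\<lambda>D. 6 - int (r D)"] by simp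
qed

theorem theorem2:
  fixes V :: "'a set" and E :: "'a set set" and vs :: "'a list" and d :: nat
  assumes "d \<ge> 6"
    and "finite_simple_graph V E"
    and "regular_graph V E d"
    and "distinct vs" and "set vs = V"
    and "adj_eigenvalue vs E 2 < real d - 5 / (real d + 1)"
  shows "\<exists>T :: nat \<Rightarrow> 'a set set.
           (\<forall>i<3. spanning_tree_of V E (T i)) \<and> disjoint_family_on T {..<3}"
proof (rule tree_packing[OF assms(2)], rule ccontr)
  fix J assume J: "J \<subseteq> E" and sparse: "\<not> 3 * (card (graph_components V J) - 1) \<le> card (E - J)"
  let ?P = "graph_components V J" and ?r = "\<lambda>C. edges_between E C (V - C)"
  have fin: "finite V" using assms(2) by (simp add: finite_simple_graph_def)
  have part: "C \<subseteq> V" "C \<noteq> {}" if "C \<in> ?P" for C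
    using that by (auto simp: graph_components_def graph_component_def)
  have finC: "finite C" if "C \<in> ?P" for C using part[OF that] fin finite_subset by blast
  \<comment> \<open>With \<open>t\<close> components,
    \<open>card (E - J) \<le> 3 * (t - 1) - 1\<close>; doubling gives \<open>6 * t - 8\<close>. The
    failed inequality forces \<open>t \<ge> 2\<close>, so the subtraction is exact.\<close>
  have "(\<Sum>C\<in>?P. ?r C) + 8 \<le> 6 * card ?P"
    using sum_component_cuts_le[OF assms(2) J] sparse by linarith
  moreover have "(\<Sum>D\<in>L. edges_between E C D) \<le> ?r C" if "C \<in> ?P" "L \<subseteq> ?P - {C}" for C L
  proof -
    have "(\<Sum>D\<in>L. edges_between E C D) = edges_between E C (\<Union>L)"
    proof (rule edges_between_Union[symmetric])
      show "\<forall>D\<in>L. finite D" using finC that(2) by blast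
      show "\<forall>C\<in>L. \<forall>D\<in>L. C \<noteq> D \<longrightarrow> C \<inter> D = {}"
        using graph_components_disjoint that(2) by (metis DiffD1 subsetD)
    qed
    also have "\<dots> \<le> ?r C"
    proof (rule edges_between_mono)
      have "D \<subseteq> V - C" if "D \<in> L" for D
      proof -
        have D: "D \<in> ?P" "C \<noteq> D" using that \<open>L \<subseteq> ?P - {C}\<close> by auto
        show ?thesis using graph_components_disjoint[OF \<open>C \<in> ?P\<close> D] part(1)[OF D(1)] by blast
      qed
      then show "\<Union>L \<subseteq> V - C" by blast
    qed (use fin in simp)
    finally show ?thesis .
  qed
  ultimately obtain C D where CD: "C \<in> ?P" "D \<in> ?P" "C \<noteq> D" "?r C \<le> 5" "?r D \<le> 5"
    "?r C + ?r D + 2 * edges_between E C D \<le> 10"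
    using exists_sparse_pair[where P = ?P and r = ?r and m = "edges_between E"]
      finite_components[OF fin] by blast
  \<comment> \<open>Both cuts have at most 5 edges, and \<open>d \<ge> 6\<close> makes this less
    than \<open>d\<close>, as the size bound requires.\<close>
  have "d + 1 \<le> card C" "d + 1 \<le> card D"
    using small_cut_imp_large_part[OF assms(2,3)] part CD assms(1) by auto
  then have "real d - 5 / (real d + 1) \<le> adj_eigenvalue vs E 2"
    using second_eigenvalue_ge_two_parts[OF assms(2-5) part(1)[OF CD(1)] part(1)[OF CD(2)]]
      graph_components_disjoint[OF CD(1-3)] CD by blast
  then show False using assms(6) by simp
qed

end
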